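(* Let $f(z)=\sum_{n=0}^\infty a_nz^n$ be analytic in the unit disk $\mathbb{D}$ with $f\in\mathcal{B}$ and $\|f\|_{\mathcal{B}}\le1$. Then $$\sum_{n=0}^\infty|a_n|r^n\le1\quad\text{for } 0\le r\le R=0.55356\ldots,$$ where $R\in(0,1)$ is the positive solution of the equation $$1-R+R\log(1-R)=0.$$ The number $R$ cannot be replaced by a number greater than $0.624162\ldots$; that is, for every $r<1$ greater than $0.624162\ldots$ there is such an $f$ for which the inequality fails at $r$.
   Context: $\mathbb{D}=\{z\in\mathbb{C}:|z|<1\}$. The Bloch space $\mathcal{B}$ is the space of analytic functions $f$ in $\mathbb{D}$ with finite Bloch norm $\|f\|_{\mathcal{B}}=|f(0)|+\sup_{z\in\mathbb{D}}(1-|z|^2)|f'(z)|$. *)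

theory Defs
  imports "HOL-Analysis.Analysis"
begin

text \<open>
  Functions on the unit disk are represented by total functions on the complex plane; only
  their restriction to \<^term>\<open>ball (0::complex) 1\<close> matters below.
\<close>

definition bloch_space :: "(complex \<Rightarrow> complex) set" where
  "bloch_space = {f. f analytic_on ball 0 1 \<and>
     bdd_above ((\<lambda>z. (1 - (norm z)\<^sup>2) * norm (deriv f z)) ` ball 0 1)}"

text \<open>The supremum is taken in the reals, so the norm is meaningful only on \<^term>\<open>bloch_space\<close>.\<close>

definition bloch_norm :: "(complex \<Rightarrow> complex) \<Rightarrow> real" where
  "bloch_norm f = norm (f 0) + (SUP z\<in>ball 0 1. (1 - (norm z)\<^sup>2) * norm (deriv f z))"

definition has_disk_expansion :: "(complex \<Rightarrow> complex) \<Rightarrow> (nat \<Rightarrow> complex) \<Rightarrow> bool" where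
  "has_disk_expansion f a \<longleftrightarrow> (\<forall>z\<in>ball 0 1. (\<lambda>n. a n * z ^ n) sums f z)"

end

theory Submission
  imports Defs
begin

text \<open>
  Let \<open>M\<close> be the supremum in the Bloch norm of \<open>f\<close>, so that \<open>norm (deriv f z) \<le> M / (1 - (norm z)\<^sup>2)\<close>.
  On the circle of radius \<open>sqrt u\<close>, Bessel's inequality turns this into a bound for the sum of
  \<open>n\<^sup>2 * (norm (a n))\<^sup>2 * u ^ (n - 1)\<close> by \<open>M\<^sup>2 / (1 - u)\<^sup>2\<close> (\<open>power_series_squares_bound\<close>). Integrating
  in \<open>u\<close> from 0 to \<open>r\<close> bounds the area sum of \<open>n * (norm (a n))\<^sup>2 * r ^ n\<close> by \<open>M\<^sup>2 * (r / (1 - r))\<close>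
  (\<open>coefficient_area_bound\<close>). Cauchy and Schwarz pair this sum with the sum of \<open>r ^ n / n\<close>, which is
  \<open>- ln (1 - r)\<close>. Hence the majorant series without its constant term is at most \<open>M\<close> as long as
  \<open>- ln (1 - r) * (r / (1 - r)) \<le> 1\<close>, and equality in this condition is the equation that defines
  \<open>R\<close> (\<open>majorant_partial_sum_bound\<close>, \<open>bloch_bohr_inequality\<close>).

  For the upper estimate of the best radius, \<open>3 sqrt 3 / 4 * z\<^sup>2\<close> has Bloch seminorm 1, and so have its
  compositions with disk automorphisms. Normalised to vanish at the origin, the composition with
  \<open>(z - a) / (1 - a z)\<close> has, for small positive \<open>a\<close>, only one negative coefficient, so its majorant is an
  explicit rational function of \<open>r\<close> (\<open>moebius_square_majorant\<close>). For \<open>a = 20 / 53\<close> it exceeds 1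
  from \<open>r = 0.624162\<close> on (\<open>extremal_majorant_gt_1\<close>).
\<close>

section \<open>Bessel's inequality by averaging over roots of unity\<close>

text \<open>
  The exponent is kept as a real difference so that the two summation indices of the squared modulus
  below can be subtracted without truncation.
\<close>
lemma sum_roots_of_unity_power:
  fixes K m n :: nat
  assumes "m < K" "n < K"
  shows "(\<Sum>k<K. cis (2 * pi * real k * (real n - real m) / real K)) = (if n = m then of_nat K else 0)"
proof (cases "n = m")
  case True
  then show ?thesis by simp
next
  case False
  define q where "q = cis (2 * pi * (real n - real m) / real K)"
  have K: "real K > 0" using assms by simp
  have "q ^ K = cis (2 * pi * (real n - real m))"
    unfolding q_def Complex.DeMoivre using K by simp
  also have "\<dots> = cis (2 * pi * of_int (int n - int m))" by simp
  also have "\<dots> = 1" by (rule cis_multiple_2pi) simp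
  finally have qK: "q ^ K = 1" .
  have "q \<noteq> 1"
  proof
    assume "q = 1"
    then have "cos (2 * pi * (real n - real m) / real K) = 1"
      by (metis q_def cis.sel(1) one_complex.sel(1))
    then obtain j :: int where "2 * pi * (real n - real m) / real K = j * 2 * pi"
      by (auto simp: cos_one_2pi_int)
    then have "(2 * pi) * (real n - real m) = (2 * pi) * (j * real K)"
      using K by (simp add: field_simps)
    then have "real n - real m = j * real K"
      by (subst (asm) mult_cancel_left) simp
    then have j: "int n - int m = j * int K"
      by (metis (mono_tags) of_int_eq_iff of_int_diff of_int_mult of_int_of_nat_eq)
    have "\<bar>int n - int m\<bar> < int K" using assms by linarith
    then have "\<bar>j\<bar> * int K < 1 * int K" by (simp add: j abs_mult)
    then have "\<bar>j\<bar> < 1" by (subst (asm) mult_less_cancel_right) auto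
    then show False using j False by simp
  qed
  have "(\<Sum>k<K. cis (2 * pi * real k * (real n - real m) / real K)) = (\<Sum>k<K. q ^ k)"
    by (intro sum.cong) (simp_all add: q_def Complex.DeMoivre algebra_simps)
  also have "\<dots> = 0" using \<open>q \<noteq> 1\<close> qK by (simp add: sum_gp_strict)
  finally show ?thesis using False by simp
qed

text \<open>
  Averaging over roots of unity replaces the integral over the circle: a polynomial of degree less
  than \<open>K\<close> is determined by its values at the \<open>K\<close>-th roots of unity, and the cross terms cancel there
  by orthogonality.
\<close>
lemma discrete_parseval:
  fixes c :: "nat \<Rightarrow> complex"
  shows "(\<Sum>k<K. (norm (\<Sum>n<K. c n * cis (2 * pi * real k / real K) ^ n))\<^sup>2)
    = real K * (\<Sum>n<K. (norm (c n))\<^sup>2)"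
proof -
  let ?w = "\<lambda>k. cis (2 * pi * real k / real K)"
  have "complex_of_real (\<Sum>k<K. (norm (\<Sum>n<K. c n * ?w k ^ n))\<^sup>2)
    = (\<Sum>k<K. (\<Sum>n<K. c n * ?w k ^ n) * cnj (\<Sum>m<K. c m * ?w k ^ m))"
    by (simp only: of_real_sum complex_norm_square)
  also have "\<dots> = (\<Sum>k<K. \<Sum>n<K. \<Sum>m<K. c n * cnj (c m)
      * cis (2 * pi * real k * (real n - real m) / real K))"
  proof (intro sum.cong refl)
    fix k
    have w: "?w k ^ n * cnj (?w k ^ m) = cis (2 * pi * real k * (real n - real m) / real K)" for n m
      unfolding Complex.DeMoivre cis_cnj cis_mult by (rule arg_cong[where f = cis]) (simp add: diff_divide_distrib algebra_simps)
    show "(\<Sum>n<K. c n * ?w k ^ n) * cnj (\<Sum>m<K. c m * ?w k ^ m) = (\<Sum>n<K. \<Sum>m<K. c n * cnj (c m)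
      * cis (2 * pi * real k * (real n - real m) / real K))"
      unfolding cnj_sum sum_product by (intro sum.cong refl) (subst w[symmetric], simp only: complex_cnj_mult mult_ac)
  qed
  also have "\<dots> = (\<Sum>n<K. \<Sum>m<K. c n * cnj (c m)
      * (\<Sum>k<K. cis (2 * pi * real k * (real n - real m) / real K)))"
    unfolding sum_distrib_left
    by (subst sum.swap) (intro sum.cong refl sum.swap)
  also have "\<dots> = (\<Sum>n<K. \<Sum>m<K. if n = m then c n * cnj (c m) * of_nat K else 0)"
    by (intro sum.cong refl) (auto simp: sum_roots_of_unity_power)
  also have "\<dots> = complex_of_real (real K * (\<Sum>n<K. (norm (c n))\<^sup>2))"
    by (simp add: sum_distrib_left complex_norm_square[symmetric] mult.commute)
  finally show ?thesis by (simp only: of_real_eq_iff)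
qed

text \<open>
  Truncating the series at \<open>K\<close> terms changes it on the unit circle by at most the tail \<open>e K\<close> of the
  absolute sums. So the truncated polynomial is bounded by \<open>B + e K\<close>, the discrete identity bounds its
  mean square, and \<open>e K\<close> tends to 0.
\<close>
lemma bessel_inequality_on_circle:
  fixes c :: "nat \<Rightarrow> complex"
  assumes summ: "summable (\<lambda>n. norm (c n))"
    and bound: "\<And>w. norm w = 1 \<Longrightarrow> norm (\<Sum>n. c n * w ^ n) \<le> B"
  shows "(\<Sum>n<N. (norm (c n))\<^sup>2) \<le> B\<^sup>2"
proof -
  define e where "e K = (\<Sum>n. norm (c n)) - (\<Sum>n<K. norm (c n))" for K
  have "(\<lambda>K. (\<Sum>n. norm (c n)) - (\<Sum>n<K. norm (c n))) \<longlonglongrightarrow> (\<Sum>n. norm (c n)) - (\<Sum>n. norm (c n))"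
    by (intro tendsto_intros summable_LIMSEQ summ)
  then have "e \<longlonglongrightarrow> 0" by (simp add: e_def[abs_def])
  then have lim: "(\<lambda>K. (B + e K)\<^sup>2) \<longlonglongrightarrow> (B + 0)\<^sup>2"
    by (intro tendsto_intros)
  have part: "norm (\<Sum>n<K. c n * w ^ n) \<le> B + e K" if w: "norm w = 1" for K w
  proof -
    have nw: "norm (c n * w ^ n) = norm (c n)" for n
      using w by (simp add: norm_mult norm_power)
    have s: "summable (\<lambda>n. norm (c n * w ^ n))" using summ by (simp only: nw)
    have sc: "summable (\<lambda>n. c n * w ^ n)" using s by (rule summable_norm_cancel)
    have split: "(\<Sum>n<K. c n * w ^ n) = (\<Sum>n. c n * w ^ n) - (\<Sum>n. c (n + K) * w ^ (n + K))"
      using suminf_minus_initial_segment[OF sc, of K] by simp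
    have "norm (\<Sum>n. c (n + K) * w ^ (n + K)) \<le> (\<Sum>n. norm (c (n + K) * w ^ (n + K)))"
      by (rule summable_norm) (use s summable_iff_shift[of "\<lambda>n. norm (c n * w ^ n)" K] in simp)
    also have "\<dots> = e K"
      unfolding nw e_def using suminf_minus_initial_segment[OF summ, of K] .
    finally show ?thesis
      unfolding split by (intro order_trans[OF norm_triangle_ineq4] add_mono bound[OF w])
  qed
  have "(\<Sum>n<N. (norm (c n))\<^sup>2) \<le> (B + e K)\<^sup>2" if K: "K \<ge> Suc N" for K
  proof -
    have "(\<Sum>n<N. (norm (c n))\<^sup>2) \<le> (\<Sum>n<K. (norm (c n))\<^sup>2)"
      using K by (intro sum_mono2) auto
    moreover have "real K * (\<Sum>n<K. (norm (c n))\<^sup>2) \<le> real K * (B + e K)\<^sup>2"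
    proof -
      have "(\<Sum>k<K. (norm (\<Sum>n<K. c n * cis (2 * pi * real k / real K) ^ n))\<^sup>2)
        \<le> (\<Sum>k<K. (B + e K)\<^sup>2)"
        by (intro sum_mono power_mono part) auto
      then show ?thesis by (simp add: discrete_parseval)
    qed
    ultimately show ?thesis using K by (subst (asm) mult_le_cancel_left_pos) auto
  qed
  then have "(\<Sum>n<N. (norm (c n))\<^sup>2) \<le> (B + 0)\<^sup>2"
    by (intro LIMSEQ_le_const[OF lim]) blast
  then show ?thesis by simp
qed

section \<open>Coefficient estimates and the majorant series\<close>

text \<open>
  On the circle of radius \<open>sqrt u\<close> the function is bounded by the constant \<open>M / (1 - u)\<close>, so Bessel's
  inequality applies to the coefficients rescaled by \<open>sqrt u ^ n\<close>.
\<close>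
lemma power_series_squares_bound:
  fixes b :: "nat \<Rightarrow> complex" and u M :: real
  assumes sums: "\<And>z. norm z < 1 \<Longrightarrow> (\<lambda>n. b n * z ^ n) sums g z"
    and bound: "\<And>z. norm z < 1 \<Longrightarrow> (1 - (norm z)\<^sup>2) * norm (g z) \<le> M"
    and u: "0 \<le> u" "u < 1"
  shows "(\<Sum>n<N. (norm (b n))\<^sup>2 * u ^ n) \<le> M\<^sup>2 / (1 - u)\<^sup>2"
proof -
  define \<rho> where "\<rho> = sqrt u"
  have \<rho>: "0 \<le> \<rho>" "\<rho> < 1" "\<rho>\<^sup>2 = u" using u by (auto simp: \<rho>_def)
  define c where "c n = b n * of_real \<rho> ^ n" for n
  \<comment> \<open>convergence at the midpoint of \<open>\<rho>\<close> and 1 gives absolute convergence at \<open>\<rho>\<close>\<close>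
  have "summable (\<lambda>n. b n * of_real ((1 + \<rho>) / 2) ^ n)"
    using \<rho> by (intro sums_summable[OF sums]) (simp del: of_real_divide of_real_add)
  then have "summable (\<lambda>n. norm (b n * of_real \<rho> ^ n))"
    by (rule powser_insidea) (use \<rho> in \<open>simp del: of_real_divide of_real_add\<close>)
  then have "summable (\<lambda>n. norm (c n))" by (simp add: c_def)
  moreover have "norm (\<Sum>n. c n * w ^ n) \<le> M / (1 - u)" if w: "norm w = 1" for w
  proof -
    have nz: "norm (of_real \<rho> * w) = \<rho>" using w \<rho> by (simp add: norm_mult)
    have "(\<Sum>n. c n * w ^ n) = g (of_real \<rho> * w)"
      using sums[of "of_real \<rho> * w"] nz \<rho>
      by (simp add: c_def power_mult_distrib mult.assoc sums_iff)
    then show ?thesis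
      using bound[of "of_real \<rho> * w"] nz \<rho> u by (simp add: field_simps)
  qed
  ultimately have "(\<Sum>n<N. (norm (c n))\<^sup>2) \<le> (M / (1 - u))\<^sup>2"
    by (rule bessel_inequality_on_circle)
  moreover have "(norm (c n))\<^sup>2 = (norm (b n))\<^sup>2 * u ^ n" for n
    using \<rho>(1) by (simp add: c_def norm_mult norm_power power_mult_distrib flip: \<rho>(3) power_mult)
      (simp add: mult.commute)
  ultimately show ?thesis by (simp add: power_divide)
qed

text \<open>
  Up to the factor \<open>pi\<close> the left side is, in the limit, the area (with multiplicity) of the image of the
  disk of radius \<open>sqrt u\<close>, and the right side is the area that a derivative of modulus
  \<open>M / (1 - (norm z)\<^sup>2)\<close> would give. The mean-square estimate is the derivative in \<open>u\<close> of this one: the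
  difference \<open>h\<close> of the two sides vanishes at 0, and its derivative is nonnegative by that estimate.
\<close>
lemma coefficient_area_bound:
  fixes a :: "nat \<Rightarrow> complex" and u M :: real
  assumes sums: "\<And>z. norm z < 1 \<Longrightarrow> (\<lambda>n. diffs a n * z ^ n) sums g z"
    and bound: "\<And>z. norm z < 1 \<Longrightarrow> (1 - (norm z)\<^sup>2) * norm (g z) \<le> M"
    and u: "0 \<le> u" "u < 1"
  shows "(\<Sum>n<N. real (Suc n) * (norm (a (Suc n)))\<^sup>2 * u ^ Suc n) \<le> M\<^sup>2 * (u / (1 - u))"
proof -
  define h where "h t = M\<^sup>2 * (t / (1 - t))
    - (\<Sum>n<N. real (Suc n) * (norm (a (Suc n)))\<^sup>2 * t ^ Suc n)" for t
  have "h 0 \<le> h u"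
  proof (rule DERIV_nonneg_imp_nondecreasing[OF u(1)])
    fix t assume t: "0 \<le> t" "t \<le> u"
    let ?S = "\<Sum>n<N. (norm (diffs a n))\<^sup>2 * t ^ n"
    have "((\<lambda>t. real (Suc n) * (norm (a (Suc n)))\<^sup>2 * t ^ Suc n) has_real_derivative
      real (Suc n) * (norm (a (Suc n)))\<^sup>2 * (real (Suc n) * t ^ n)) (at t)" for n
      using DERIV_cmult[OF DERIV_pow[of "Suc n" t]] by (simp del: of_nat_Suc power_Suc)
    moreover have "((\<lambda>t. M\<^sup>2 * (t / (1 - t))) has_real_derivative M\<^sup>2 * (1 / (1 - t)\<^sup>2)) (at t)"
      using t u by (auto intro!: derivative_eq_intros simp: power2_eq_square algebra_simps)
    ultimately have "(h has_real_derivative M\<^sup>2 * (1 / (1 - t)\<^sup>2)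
      - (\<Sum>n<N. real (Suc n) * (norm (a (Suc n)))\<^sup>2 * (real (Suc n) * t ^ n))) (at t)"
      unfolding h_def by (intro DERIV_diff DERIV_sum)
    moreover have "(\<Sum>n<N. real (Suc n) * (norm (a (Suc n)))\<^sup>2 * (real (Suc n) * t ^ n)) = ?S"
      by (intro sum.cong refl) (simp add: diffs_def norm_mult power2_eq_square del: of_nat_Suc)
    moreover have "?S \<le> M\<^sup>2 / (1 - t)\<^sup>2"
      using t u by (intro power_series_squares_bound[OF sums bound]) auto
    ultimately show "\<exists>y. (h has_real_derivative y) (at t) \<and> 0 \<le> y"
      by (intro exI conjI) (assumption, simp)
  qed
  then show ?thesis by (simp add: h_def)
qed

lemma log_partial_sum_bound:
  fixes r :: real
  assumes "0 \<le> r" "r < 1"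
  shows "(\<Sum>n<N. r ^ Suc n / real (Suc n)) \<le> - ln (1 - r)"
proof -
  have s: "(\<lambda>n. r ^ n / real n) sums (- ln (1 - r))"
    using sums_minus[OF ln_series'[of "- r"]] assms by simp
  have "(\<Sum>n<N. r ^ Suc n / real (Suc n)) = (\<Sum>n<Suc N. r ^ n / real n)"
    by (simp add: sum.lessThan_Suc_shift del: sum.lessThan_Suc)
  also have "\<dots> \<le> - ln (1 - r)"
    using s assms by (metis (no_types, lifting) sum_le_suminf finite_lessThan sums_iff
        divide_nonneg_nonneg zero_le_power of_nat_0_le_iff)
  finally show ?thesis .
qed

text \<open>
  Split each term as \<open>sqrt (r ^ n / n) * (norm (a n) * sqrt (n * r ^ n))\<close>. By Cauchy and Schwarz, the
  square of the sum is at most the product of a partial sum of \<open>- ln (1 - r)\<close> and the area sum at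
  \<open>u = r\<close>. This product is where the critical equation comes from.
\<close>
lemma majorant_partial_sum_bound:
  fixes a :: "nat \<Rightarrow> complex" and r M :: real
  assumes sums: "\<And>z. norm z < 1 \<Longrightarrow> (\<lambda>n. diffs a n * z ^ n) sums g z"
    and bound: "\<And>z. norm z < 1 \<Longrightarrow> (1 - (norm z)\<^sup>2) * norm (g z) \<le> M"
    and M: "0 \<le> M" and r: "0 \<le> r" "r < 1"
    and r_log: "- ln (1 - r) * (r / (1 - r)) \<le> 1"
  shows "(\<Sum>n<N. norm (a (Suc n)) * r ^ Suc n) \<le> M"
proof (rule power2_le_imp_le)
  let ?p = "\<lambda>n. sqrt (r ^ Suc n / real (Suc n))"
  let ?q = "\<lambda>n. norm (a (Suc n)) * sqrt (real (Suc n) * r ^ Suc n)"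
  have pq: "?p n * ?q n = norm (a (Suc n)) * r ^ Suc n" for n
  proof -
    have "?p n * ?q n = norm (a (Suc n)) * sqrt (r ^ Suc n / real (Suc n) * (real (Suc n) * r ^ Suc n))"
      by (simp only: real_sqrt_mult mult_ac)
    also have "r ^ Suc n / real (Suc n) * (real (Suc n) * r ^ Suc n) = (r ^ Suc n)\<^sup>2"
      by (simp add: power2_eq_square del: of_nat_Suc power_Suc)
    finally show ?thesis using r by simp
  qed
  have "(\<Sum>n<N. norm (a (Suc n)) * r ^ Suc n)\<^sup>2 = (\<Sum>n<N. ?p n * ?q n)\<^sup>2"
    by (simp only: pq)
  also have "\<dots> \<le> (\<Sum>n<N. (?p n)\<^sup>2) * (\<Sum>n<N. (?q n)\<^sup>2)"
    by (rule Cauchy_Schwarz_ineq_sum)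
  also have "(\<Sum>n<N. (?p n)\<^sup>2) = (\<Sum>n<N. r ^ Suc n / real (Suc n))"
    using r by (intro sum.cong refl real_sqrt_pow2) (auto intro!: divide_nonneg_nonneg mult_nonneg_nonneg)
  also have "(\<Sum>n<N. (?q n)\<^sup>2) = (\<Sum>n<N. real (Suc n) * (norm (a (Suc n)))\<^sup>2 * r ^ Suc n)"
    using r by (intro sum.cong refl) (simp add: power_mult_distrib del: of_nat_Suc power_Suc)
  also have "(\<Sum>n<N. r ^ Suc n / real (Suc n)) * \<dots> \<le> (- ln (1 - r)) * (M\<^sup>2 * (r / (1 - r)))"
    using r by (intro mult_mono log_partial_sum_bound coefficient_area_bound[OF sums bound])
      (auto intro!: sum_nonneg)
  also have "\<dots> = M\<^sup>2 * (- ln (1 - r) * (r / (1 - r)))" by simp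
  also have "\<dots> \<le> M\<^sup>2 * 1" by (intro mult_left_mono r_log) simp
  finally show "(\<Sum>n<N. norm (a (Suc n)) * r ^ Suc n)\<^sup>2 \<le> M\<^sup>2" by simp
qed (rule M)

text \<open>
  For \<open>0 \<le> x < 1\<close>, the sign condition \<open>0 \<le> bohr_gauge x\<close> is the condition
  \<open>- ln (1 - x) * (x / (1 - x)) \<le> 1\<close> cleared of its denominator.
\<close>
definition bohr_gauge :: "real \<Rightarrow> real" where
  "bohr_gauge x = 1 - x + x * ln (1 - x)"

text \<open>
  The supremum \<open>M\<close> in the Bloch norm bounds the series without its constant term, and
  \<open>norm (a 0) + M\<close> is the Bloch norm itself.
\<close>
lemma bloch_bohr_inequality:
  assumes f: "f \<in> bloch_space" "bloch_norm f \<le> 1" "has_disk_expansion f a"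
    and r: "0 \<le> r" "r < 1" and gauge: "0 \<le> bohr_gauge r"
  shows "summable (\<lambda>n. norm (a n) * r ^ n) \<and> (\<Sum>n. norm (a n) * r ^ n) \<le> 1"
proof -
  let ?F = "\<lambda>z. (1 - (norm z)\<^sup>2) * norm (deriv f z)"
  define M where "M = (SUP z\<in>ball 0 1. ?F z)"
  have bdd: "bdd_above (?F ` ball 0 1)" and an: "f analytic_on ball 0 1"
    using f(1) by (auto simp: bloch_space_def)
  have bound: "?F z \<le> M" if "norm z < 1" for z
    unfolding M_def using that by (intro cSUP_upper[OF _ bdd]) simp
  have M: "0 \<le> M" using order_trans[OF norm_ge_zero bound[of 0, simplified]] .
  have exp: "(\<lambda>n. a n * z ^ n) sums f z" if "norm z < 1" for z
    using f(3) that by (simp add: has_disk_expansion_def)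
  have "(\<lambda>n. diffs a n * z ^ n) sums deriv f z" if z: "norm z < 1" for z
  proof (rule termdiffs_sums_strong[OF exp _ z])
    show "(f has_field_derivative deriv f z) (at z)"
      using an z analytic_on_imp_differentiable_at[of f "ball 0 1" z]
      by (simp add: DERIV_deriv_iff_field_differentiable)
  qed
  moreover have "- ln (1 - r) * (r / (1 - r)) \<le> 1"
    using gauge r by (simp add: bohr_gauge_def field_simps)
  ultimately have part: "(\<Sum>n<N. norm (a (Suc n)) * r ^ Suc n) \<le> M" for N
    using majorant_partial_sum_bound[OF _ bound M r] by blast
  have "a 0 = f 0" using exp[of 0] by (simp add: powser_sums_zero_iff)
  then have "norm (a 0) + M \<le> 1" using f(2) by (simp add: bloch_norm_def M_def)
  then have le: "(\<Sum>n<N. norm (a n) * r ^ n) \<le> 1" for N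
    using part[of "N - 1"] M by (cases N) (simp_all add: sum.lessThan_Suc_shift del: sum.lessThan_Suc)
  have "summable (\<lambda>n. norm (a n) * r ^ n)"
    using le r by (intro summableI_nonneg_bounded[where x = 1]) auto
  then show ?thesis using le suminf_le_const by blast
qed

section \<open>The critical radius\<close>

lemma bohr_gauge_strict_decreasing:
  assumes "0 \<le> x" "x < y" "y < 1"
  shows "bohr_gauge y < bohr_gauge x"
proof (rule DERIV_neg_imp_decreasing[OF assms(2)])
  fix t assume t: "x \<le> t" "t \<le> y"
  have "(bohr_gauge has_real_derivative - 1 + ln (1 - t) - t / (1 - t)) (at t)"
    unfolding bohr_gauge_def[abs_def] using t assms
    by (auto intro!: derivative_eq_intros simp: field_simps)
  moreover have "ln (1 - t) \<le> 0" "0 \<le> t / (1 - t)" using t assms by auto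
  ultimately show "\<exists>d. (bohr_gauge has_real_derivative d) (at t) \<and> d < 0"
    by (intro exI conjI) (assumption, simp)
qed

lemma bohr_gauge_bracket:
  shows "bohr_gauge 0.55356 > 0" and "bohr_gauge 0.55357 < 0"
proof -
  \<comment> \<open>six terms of the artanh series for \<open>ln\<close>, which needs an argument above 1\<close>
  have "ln (1 / 0.44644 :: real) < 0.44644 / 0.55356"
    using ln_approx_bounds[of "1 / 0.44644" 6]
    by (simp add: eval_nat_numeral)
  then have "ln (0.44644::real) > - 0.44644 / 0.55356" by (simp add: ln_div)
  then show "bohr_gauge 0.55356 > 0" by (simp add: bohr_gauge_def)
  have "ln (1 / 0.44643 :: real) > 0.44643 / 0.55357"
    using ln_approx_bounds[of "1 / 0.44643" 6]
    by (simp add: eval_nat_numeral)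
  then have "ln (0.44643::real) < - 0.44643 / 0.55357" by (simp add: ln_div)
  then show "bohr_gauge 0.55357 < 0" by (simp add: bohr_gauge_def)
qed

section \<open>Moebius transforms of the square function\<close>

text \<open>
  An automorphism of the unit disk when \<open>a\<close> is real with \<open>\<bar>a\<bar> < 1\<close>. The general field type serves the
  complex function and its majorant series, which is summed over the reals.
\<close>
definition disk_automorphism :: "'a::real_normed_field \<Rightarrow> 'a \<Rightarrow> 'a" where
  "disk_automorphism a z = (z - a) / (1 - a * z)"

text \<open>
  These are the Taylor coefficients of the square of the automorphism, minus its constant term. The
  division by \<open>a\<close> stands for the power \<open>a ^ (n - 2)\<close>, whose exponent is negative for \<open>n = 1\<close>.
\<close>
definition moebius_square_coeff :: "real \<Rightarrow> nat \<Rightarrow> real" where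
  "moebius_square_coeff a n =
    (if n = 0 then 0 else (1 - a\<^sup>2) * a ^ (n - 1) * ((1 - a\<^sup>2) * real (n - 1) - 2 * a\<^sup>2) / a)"

text \<open>
  With \<open>w = a z\<close> and \<open>q = 1 - w\<close> the automorphism is \<open>- a + (1 - a\<^sup>2) z / q\<close>. Squaring leaves a simple
  and a double pole in \<open>w\<close>, that is, the geometric series and its derivative.
\<close>
lemma moebius_square_expansion:
  fixes z :: "'a :: {real_normed_field,banach}" and a :: real
  assumes a: "a \<noteq> 0" and z: "norm (of_real a * z) < 1"
  shows "(\<lambda>n. of_real (moebius_square_coeff a n) * z ^ n) sums
    ((disk_automorphism (of_real a) z)\<^sup>2 - (of_real a)\<^sup>2)"
proof -
  define A where "A = (of_real a :: 'a)"
  define w where "w = A * z"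
  have w: "norm w < 1" and A: "A \<noteq> 0" using z a by (auto simp: w_def A_def)
  have w1: "1 - w \<noteq> 0" using w by auto
  have g: "(\<lambda>n. w ^ n) sums (1 / (1 - w))" using w by (rule geometric_sums)
  have "(\<lambda>n. of_nat (Suc n) * w ^ n - w ^ n) sums (1 / (1 - w)\<^sup>2 - 1 / (1 - w))"
    by (intro sums_diff geometric_deriv_sums g w)
  then have d: "(\<lambda>n. of_nat n * w ^ n) sums (1 / (1 - w)\<^sup>2 - 1 / (1 - w))"
    by (simp add: algebra_simps)
  have "(\<lambda>n. (1 - A\<^sup>2) * z / A * ((1 - A\<^sup>2) * (of_nat n * w ^ n) - 2 * A\<^sup>2 * w ^ n)) sums
    ((1 - A\<^sup>2) * z / A * ((1 - A\<^sup>2) * (1 / (1 - w)\<^sup>2 - 1 / (1 - w)) - 2 * A\<^sup>2 * (1 / (1 - w))))"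
    by (intro sums_mult sums_diff g d)
  moreover have "(1 - A\<^sup>2) * z / A * ((1 - A\<^sup>2) * (of_nat n * w ^ n) - 2 * A\<^sup>2 * w ^ n)
    = of_real (moebius_square_coeff a (Suc n)) * z ^ Suc n" for n
  proof -
    have "(1 - A\<^sup>2) * z / A * ((1 - A\<^sup>2) * (of_nat n * w ^ n) - 2 * A\<^sup>2 * w ^ n)
      = (1 - A\<^sup>2) * A ^ n * ((1 - A\<^sup>2) * of_nat n - 2 * A\<^sup>2) / A * z ^ Suc n"
      unfolding w_def power_mult_distrib using A by (simp add: field_simps)
    then show ?thesis by (simp add: moebius_square_coeff_def A_def)
  qed
  moreover have "(1 - A\<^sup>2) * z / A * ((1 - A\<^sup>2) * (1 / (1 - w)\<^sup>2 - 1 / (1 - w)) - 2 * A\<^sup>2 * (1 / (1 - w)))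
    = (disk_automorphism A z)\<^sup>2 - A\<^sup>2"
  proof -
    define q where "q = 1 - w"
    have q: "q \<noteq> 0" "A * z = 1 - q" using w1 by (auto simp: q_def w_def)
    have double_pole: "1 / q\<^sup>2 - 1 / q = A * z / q\<^sup>2" using q by (simp add: power2_eq_square field_simps)
    have "(1 - A\<^sup>2) * z / A * ((1 - A\<^sup>2) * (1 / q\<^sup>2 - 1 / q) - 2 * A\<^sup>2 * (1 / q))
      = (1 - A\<^sup>2) * z * ((1 - A\<^sup>2) * z - 2 * A * q) / q\<^sup>2"
      unfolding double_pole using q(1) A by (simp add: power2_eq_square field_simps)
    also have "(1 - A\<^sup>2) * z * ((1 - A\<^sup>2) * z - 2 * A * q) = (z - A)\<^sup>2 - A\<^sup>2 * q\<^sup>2"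
      unfolding q_def w_def by (simp add: power2_eq_square algebra_simps)
    also have "\<dots> / q\<^sup>2 = (disk_automorphism A z)\<^sup>2 - A\<^sup>2"
    proof -
      have "disk_automorphism A z = (z - A) / q"
        by (simp add: disk_automorphism_def q_def w_def)
      then show ?thesis using q by (simp only: power_divide) (simp add: diff_divide_distrib)
    qed
    finally show ?thesis by (simp add: q_def)
  qed
  ultimately have "(\<lambda>n. of_real (moebius_square_coeff a (Suc n)) * z ^ Suc n) sums
    ((disk_automorphism A z)\<^sup>2 - A\<^sup>2)"
    by simp
  then show ?thesis
    by (subst (asm) sums_Suc_iff) (simp add: moebius_square_coeff_def A_def)
qed

text \<open>
  If \<open>3 a\<^sup>2 \<le> 1\<close>, the linear coefficient \<open>- 2 a (1 - a\<^sup>2)\<close> is the only negative one. So taking absolute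
  values only adds twice the modulus of the linear term to the series.
\<close>
lemma moebius_square_majorant:
  fixes a r :: real
  assumes a: "0 < a" "3 * a\<^sup>2 \<le> 1" and r: "0 \<le> r" "r < 1"
  shows "(\<lambda>n. \<bar>moebius_square_coeff a n\<bar> * r ^ n) sums
    ((disk_automorphism a r)\<^sup>2 - a\<^sup>2 + 4 * a * (1 - a\<^sup>2) * r)"
proof -
  have "a\<^sup>2 < 1\<^sup>2" using a by simp
  then have a1: "a < 1" by (rule power2_less_imp_less) simp
  have "a * r < 1 * 1" using a a1 r by (intro mult_strict_mono') auto
  then have ar: "norm (of_real a * r) < 1" using a r by (simp add: abs_mult)
  have "(\<lambda>n. of_real (moebius_square_coeff a n) * r ^ n + (if n = 1 then 4 * a * (1 - a\<^sup>2) * r else 0)) sums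
    ((disk_automorphism (of_real a) r)\<^sup>2 - (of_real a)\<^sup>2 + 4 * a * (1 - a\<^sup>2) * r)"
    using a by (intro sums_add moebius_square_expansion[OF _ ar]
        sums_single[of 1 "\<lambda>_. 4 * a * (1 - a\<^sup>2) * r"]) auto
  moreover have "of_real (moebius_square_coeff a n) * r ^ n + (if n = 1 then 4 * a * (1 - a\<^sup>2) * r else 0)
     = \<bar>moebius_square_coeff a n\<bar> * r ^ n" for n
  proof -
    consider "n = 0" | "n = 1" | m where "n = Suc (Suc m)"
      by (metis One_nat_def not0_implies_Suc)
    then show ?thesis
    proof cases
      case 2
      have "moebius_square_coeff a 1 = - (2 * a * (1 - a\<^sup>2))"
        using a by (simp add: moebius_square_coeff_def power2_eq_square)
      moreover have "\<bar>- (2 * a * (1 - a\<^sup>2))\<bar> = 2 * a * (1 - a\<^sup>2)" using a \<open>a\<^sup>2 < 1\<^sup>2\<close> by (simp add: abs_mult)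
      ultimately have "moebius_square_coeff a 1 + 4 * a * (1 - a\<^sup>2) = \<bar>moebius_square_coeff a 1\<bar>" by simp
      then show ?thesis using 2 by (simp flip: distrib_right)
    next
      case 3
      have "0 \<le> (1 - a\<^sup>2) * 1 - 2 * a\<^sup>2" using a by simp
      also have "\<dots> \<le> (1 - a\<^sup>2) * real (Suc m) - 2 * a\<^sup>2"
        using \<open>a\<^sup>2 < 1\<^sup>2\<close> by (intro diff_right_mono mult_left_mono) auto
      finally have "0 \<le> (1 - a\<^sup>2) * real (Suc m) - 2 * a\<^sup>2" .
      then have "0 \<le> moebius_square_coeff a n"
        unfolding moebius_square_coeff_def 3 using a \<open>a\<^sup>2 < 1\<^sup>2\<close>
        by (auto intro!: divide_nonneg_pos mult_nonneg_nonneg)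
      then show ?thesis using 3 by simp
    qed (simp add: moebius_square_coeff_def)
  qed
  ultimately show ?thesis by simp
qed

text \<open>
  The factor makes the Bloch seminorm of \<open>3 sqrt 3 / 4 * z\<^sup>2\<close> equal to 1, and the seminorm is invariant
  under disk automorphisms. Subtracting \<open>a\<^sup>2\<close> gives the value 0 at the origin, so that the norm is
  the seminorm.
\<close>
definition moebius_bloch :: "real \<Rightarrow> complex \<Rightarrow> complex" where
  "moebius_bloch a z = of_real (3 * sqrt 3 / 4) * ((disk_automorphism (of_real a) z)\<^sup>2 - (of_real a)\<^sup>2)"

text \<open>
  Equality holds at \<open>t = 1 / sqrt 3\<close>: the gap is a multiple of \<open>(s - 1)\<^sup>2 (s + 2)\<close> with
  \<open>s = sqrt 3 * t\<close>.
\<close>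
lemma cubic_bound: "(3 * sqrt 3 / 2) * (t * (1 - t\<^sup>2)) \<le> 1" if "0 \<le> t" for t :: real
proof -
  have "0 \<le> (sqrt 3 * t - 1)\<^sup>2 * (sqrt 3 * t + 2)"
    using that by (intro mult_nonneg_nonneg) auto
  also have "\<dots> = 2 - 2 * ((3 * sqrt 3 / 2) * (t * (1 - t\<^sup>2)))"
  proof -
    have "sqrt 3 * sqrt 3 = (3::real)" by simp
    then show ?thesis by (simp add: power2_eq_square algebra_simps diff_divide_distrib)
  qed
  finally show ?thesis by linarith
qed

lemma moebius_denominator_nonzero:
  fixes z :: complex
  assumes "\<bar>a\<bar> < 1" "norm z < 1"
  shows "1 - of_real a * z \<noteq> 0"
proof -
  have "\<bar>a\<bar> * norm z < 1 * 1" using assms by (intro mult_strict_mono') auto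
  then have "norm (of_real a * z) < 1" by (simp add: norm_mult)
  then show ?thesis by auto
qed

lemma disk_automorphism_schwarz_pick:
  fixes z :: complex
  assumes a: "\<bar>a\<bar> < 1" and z: "norm z < 1"
  shows "1 - (norm (disk_automorphism (of_real a) z))\<^sup>2
    = (1 - a\<^sup>2) * (1 - (norm z)\<^sup>2) / (norm (1 - of_real a * z))\<^sup>2"
proof -
  have nz: "(norm (1 - of_real a * z))\<^sup>2 \<noteq> 0" using moebius_denominator_nonzero[OF a z] by simp
  have "(norm (1 - of_real a * z))\<^sup>2 - (norm (z - of_real a))\<^sup>2 = (1 - a\<^sup>2) * (1 - (norm z)\<^sup>2)"
    unfolding cmod_power2 by (simp add: power2_eq_square algebra_simps)
  then show ?thesis
    using nz by (simp add: disk_automorphism_def norm_divide power_divide diff_divide_eq_iff)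
qed

lemma moebius_bloch_derivative:
  assumes a: "\<bar>a\<bar> < 1" and z: "norm z < 1"
  shows "(moebius_bloch a has_field_derivative
    of_real (3 * sqrt 3 / 2) * disk_automorphism (of_real a) z
      * (of_real (1 - a\<^sup>2) / (1 - of_real a * z)\<^sup>2)) (at z)"
proof -
  have nz: "1 - of_real a * z \<noteq> 0" by (rule moebius_denominator_nonzero[OF assms])
  have "(disk_automorphism (of_real a) has_field_derivative
      of_real (1 - a\<^sup>2) / (1 - of_real a * z)\<^sup>2) (at z)"
    unfolding disk_automorphism_def[abs_def] using nz
    by (auto intro!: derivative_eq_intros simp: power2_eq_square algebra_simps)
  then show ?thesis
    unfolding moebius_bloch_def[abs_def]
    by (auto intro!: derivative_eq_intros)
qed

text \<open>
  By the Schwarz-Pick identity, \<open>(1 - (norm z)\<^sup>2)\<close> times the modulus of the derivative of the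
  automorphism is \<open>1 - t\<^sup>2\<close>, where \<open>t\<close> is the modulus of its value. Only a function of \<open>t\<close> remains to
  be bounded.
\<close>
lemma moebius_bloch_seminorm:
  assumes a: "\<bar>a\<bar> < 1" and z: "norm z < 1"
  shows "(1 - (norm z)\<^sup>2) * norm (deriv (moebius_bloch a) z) \<le> 1"
proof -
  let ?t = "norm (disk_automorphism (of_real a) z)"
  have a2: "a\<^sup>2 < 1" using a by (simp add: abs_square_less_1)
  have "norm (deriv (moebius_bloch a) z) = (3 * sqrt 3 / 2) * ?t * ((1 - a\<^sup>2) / (norm (1 - of_real a * z))\<^sup>2)"
    unfolding DERIV_imp_deriv[OF moebius_bloch_derivative[OF a z]]
    using a2 unfolding norm_mult norm_divide norm_power norm_of_real by simp
  then have "(1 - (norm z)\<^sup>2) * norm (deriv (moebius_bloch a) z) = (3 * sqrt 3 / 2) * (?t * (1 - ?t\<^sup>2))"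
    unfolding disk_automorphism_schwarz_pick[OF a z] by simp
  also have "\<dots> \<le> 1" by (rule cubic_bound) simp
  finally show ?thesis .
qed

lemma moebius_bloch_unit_ball:
  assumes a: "\<bar>a\<bar> < 1"
  shows "moebius_bloch a \<in> bloch_space" "bloch_norm (moebius_bloch a) \<le> 1"
proof -
  have "moebius_bloch a holomorphic_on ball 0 1"
    unfolding holomorphic_on_open[OF open_ball] Ball_def mem_ball_0
    using moebius_bloch_derivative[OF a] by blast
  moreover have "bdd_above ((\<lambda>z. (1 - (norm z)\<^sup>2) * norm (deriv (moebius_bloch a) z)) ` ball 0 1)"
    using moebius_bloch_seminorm[OF a] by (intro bdd_aboveI2[where M = 1]) simp
  ultimately show "moebius_bloch a \<in> bloch_space"
    by (simp add: bloch_space_def analytic_on_open)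
  have "moebius_bloch a 0 = 0" by (simp add: moebius_bloch_def disk_automorphism_def)
  moreover have "(SUP z\<in>ball 0 1. (1 - (norm z)\<^sup>2) * norm (deriv (moebius_bloch a) z)) \<le> 1"
    using moebius_bloch_seminorm[OF a] by (intro cSUP_least) auto
  ultimately show "bloch_norm (moebius_bloch a) \<le> 1" by (simp add: bloch_norm_def)
qed

lemma moebius_bloch_expansion:
  assumes a: "0 < a" "a < 1"
  shows "has_disk_expansion (moebius_bloch a) (\<lambda>n. of_real (3 * sqrt 3 / 4 * moebius_square_coeff a n))"
  unfolding has_disk_expansion_def
proof
  fix z :: complex assume "z \<in> ball 0 1"
  then have z: "norm z < 1" by simp
  have "a * norm z < 1 * 1" using a z by (intro mult_strict_mono') auto
  then have "norm (of_real a * z) < 1" using a by (simp add: norm_mult)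
  from sums_mult[OF moebius_square_expansion[OF _ this], of "of_real (3 * sqrt 3 / 4)"]
  show "(\<lambda>n. of_real (3 * sqrt 3 / 4 * moebius_square_coeff a n) * z ^ n) sums moebius_bloch a z"
    using a unfolding moebius_bloch_def of_real_mult mult.assoc by simp
qed

text \<open>
  The majorant increases with \<open>r\<close>, so one evaluation at the left endpoint suffices. The parameter
  \<open>20 / 53\<close> is a fraction close to 0.3775, the numerical value of \<open>a\<close> for which the majorant reaches 1
  earliest, at \<open>r = 0.6241616...\<close>. The excess over 1 at 0.624162 is about \<open>9 / 10 ^ 7\<close>; replacing
  \<open>sqrt 3\<close> by 1.73205 costs half of it.
\<close>
lemma extremal_majorant_gt_1:
  fixes r :: real
  assumes "0.624162 \<le> r" "r < 1"
  defines "a \<equiv> 20 / 53"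
  shows "3 * sqrt 3 / 4 * ((disk_automorphism a r)\<^sup>2 - a\<^sup>2 + 4 * a * (1 - a\<^sup>2) * r) > 1"
proof -
  let ?s = "0.624162 :: real"
  have "1 < 3 * 1.73205 / 4 * ((disk_automorphism a ?s)\<^sup>2 - a\<^sup>2 + 4 * a * (1 - a\<^sup>2) * ?s)"
    by (simp add: disk_automorphism_def a_def power2_eq_square)
  also have "\<dots> \<le> 3 * sqrt 3 / 4 * ((disk_automorphism a r)\<^sup>2 - a\<^sup>2 + 4 * a * (1 - a\<^sup>2) * r)"
  proof (rule mult_mono)
    have "(1.73205::real) \<le> sqrt 3" by (rule real_le_rsqrt) (simp add: power2_eq_square)
    then show "3 * 1.73205 / 4 \<le> 3 * sqrt 3 / 4" by simp
    have "disk_automorphism a ?s \<le> disk_automorphism a r"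
      unfolding disk_automorphism_def
      using assms by (intro frac_le) (auto simp: a_def)
    then have "(disk_automorphism a ?s)\<^sup>2 \<le> (disk_automorphism a r)\<^sup>2"
      by (rule power_mono) (simp add: disk_automorphism_def a_def)
    moreover have "4 * a * (1 - a\<^sup>2) * ?s \<le> 4 * a * (1 - a\<^sup>2) * r"
      using assms by (intro mult_left_mono) (auto simp: a_def power2_eq_square)
    ultimately show "(disk_automorphism a ?s)\<^sup>2 - a\<^sup>2 + 4 * a * (1 - a\<^sup>2) * ?s
      \<le> (disk_automorphism a r)\<^sup>2 - a\<^sup>2 + 4 * a * (1 - a\<^sup>2) * r" by linarith
  qed (simp_all add: disk_automorphism_def a_def power2_eq_square)
  finally show ?thesis .
qed

lemma bloch_bohr_inequality_fails:
  fixes r :: real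
  assumes r: "0.624162 \<le> r" "r < 1"
  shows "\<exists>f a. f \<in> bloch_space \<and> bloch_norm f \<le> 1 \<and> has_disk_expansion f a \<and>
    summable (\<lambda>n. norm (a n) * r ^ n) \<and> (\<Sum>n. norm (a n) * r ^ n) > 1"
proof -
  define a :: real where "a = 20 / 53"
  let ?c = "\<lambda>n. complex_of_real (3 * sqrt 3 / 4 * moebius_square_coeff a n)"
  let ?S = "3 * sqrt 3 / 4 * ((disk_automorphism a r)\<^sup>2 - a\<^sup>2 + 4 * a * (1 - a\<^sup>2) * r)"
  have "(\<lambda>n. 3 * sqrt 3 / 4 * (\<bar>moebius_square_coeff a n\<bar> * r ^ n)) sums ?S"
    using r by (intro sums_mult moebius_square_majorant) (auto simp: a_def power2_eq_square)
  moreover have "3 * sqrt 3 / 4 * (\<bar>moebius_square_coeff a n\<bar> * r ^ n) = norm (?c n) * r ^ n" for n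
    unfolding norm_of_real abs_mult by simp
  ultimately have "(\<lambda>n. norm (?c n) * r ^ n) sums ?S" by (simp only:)
  moreover have "?S > 1" unfolding a_def by (rule extremal_majorant_gt_1[OF r])
  ultimately have "summable (\<lambda>n. norm (?c n) * r ^ n)" "(\<Sum>n. norm (?c n) * r ^ n) > 1"
    by (simp_all only: sums_iff)
  moreover have "\<bar>a\<bar> < 1" "0 < a" "a < 1" by (auto simp: a_def)
  ultimately show ?thesis
    using moebius_bloch_unit_ball[of a] moebius_bloch_expansion[of a] by blast
qed

section \<open>The Bohr radius of the Bloch space\<close>

theorem theorem8:
  shows "\<exists>R::real.
      (0 < R \<and> R < 1 \<and> 1 - R + R * ln (1 - R) = 0) \<and>
      (\<forall>x::real. 0 < x \<and> x < 1 \<and> 1 - x + x * ln (1 - x) = 0 \<longrightarrow> x = R) \<and>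
      0.55356 \<le> R \<and> R < 0.55357 \<and>
      (\<forall>f a. f \<in> bloch_space \<and> bloch_norm f \<le> 1 \<and> has_disk_expansion f a \<longrightarrow>
        (\<forall>r::real. 0 \<le> r \<and> r \<le> R \<longrightarrow>
          summable (\<lambda>n. norm (a n) * r ^ n) \<and> (\<Sum>n. norm (a n) * r ^ n) \<le> 1)) \<and>
      (\<forall>r::real. 0.624162 < r \<and> r < 1 \<longrightarrow>
        (\<exists>f a. f \<in> bloch_space \<and> bloch_norm f \<le> 1 \<and> has_disk_expansion f a \<and>
          summable (\<lambda>n. norm (a n) * r ^ n) \<and> (\<Sum>n. norm (a n) * r ^ n) > 1))"
proof -
  obtain R where R: "0.55356 \<le> R" "R \<le> 0.55357" and root: "bohr_gauge R = 0"
  proof -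
    have "continuous_on {0.55356..0.55357} bohr_gauge"
      unfolding bohr_gauge_def[abs_def] by (intro continuous_intros) auto
    from IVT2'[OF _ _ _ this, of 0] bohr_gauge_bracket that show ?thesis by auto
  qed
  have R1: "0 < R" "R < 1" using R by auto
  have "R \<noteq> 0.55357" using root bohr_gauge_bracket(2) by (metis less_irrefl)
  then have R_less: "R < 0.55357" using R by simp
  have unique: "x = R" if "0 < x" "x < 1" "bohr_gauge x = 0" for x
    using that root R1 bohr_gauge_strict_decreasing[of x R] bohr_gauge_strict_decreasing[of R x]
    by (cases x R rule: linorder_cases) auto
  have gauge: "0 \<le> bohr_gauge r" if "0 \<le> r" "r \<le> R" for r
    using that root R1 bohr_gauge_strict_decreasing[of r R] by (cases "r = R") auto
  have below: "summable (\<lambda>n. norm (a n) * r ^ n) \<and> (\<Sum>n. norm (a n) * r ^ n) \<le> 1"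
    if "f \<in> bloch_space" "bloch_norm f \<le> 1" "has_disk_expansion f a" "0 \<le> r" "r \<le> R" for f a r
    using that R1 by (intro bloch_bohr_inequality gauge) auto
  show ?thesis
  proof (rule exI[of _ R], intro conjI)
    show "0 < R" "R < 1" "0.55356 \<le> R" "R < 0.55357" by fact+
    show "1 - R + R * ln (1 - R) = 0" using root by (simp only: bohr_gauge_def)
    show "\<forall>x. 0 < x \<and> x < 1 \<and> 1 - x + x * ln (1 - x) = 0 \<longrightarrow> x = R"
      using unique unfolding bohr_gauge_def by blast
    show "\<forall>f a. f \<in> bloch_space \<and> bloch_norm f \<le> 1 \<and> has_disk_expansion f a \<longrightarrow>
        (\<forall>r. 0 \<le> r \<and> r \<le> R \<longrightarrow>
          summable (\<lambda>n. norm (a n) * r ^ n) \<and> (\<Sum>n. norm (a n) * r ^ n) \<le> 1)"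
      using below by blast
    show "\<forall>r. 0.624162 < r \<and> r < 1 \<longrightarrow>
        (\<exists>f a. f \<in> bloch_space \<and> bloch_norm f \<le> 1 \<and> has_disk_expansion f a \<and>
          summable (\<lambda>n. norm (a n) * r ^ n) \<and> (\<Sum>n. norm (a n) * r ^ n) > 1)"
      using bloch_bohr_inequality_fails less_imp_le by blast
  qed
qed

end
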